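(* Let $\mathcal{M}=(W,R,V)$ and $\mathcal{M}'=(W',R',V')$ be Kripke models and let $Z\subseteq W\times W'$ be a (non-empty) graded bisimulation between $\mathcal{M}$ and $\mathcal{M}'$. Define a tuple of relations $\mathcal{Z}=(\mathcal{Z}_1,\mathcal{Z}_2,\ldots)$ by $\mathcal{Z}_1=\{(\{w\},\{w'\}): wZw'\}$ and, for $n>1$, $\mathcal{Z}_n=\{(X,X'): X\subseteq W,\ X'\subseteq W',\ |X|=|X'|=n,\ X\text{ and }X'\text{ form a }Z\text{-pair}\}$. Then $\mathcal{Z}$ is a graded tuple bisimulation between $\mathcal{M}$ and $\mathcal{M}'$.
   Context: $\mathbb{N}$ includes $0$. A Kripke model is $(W,R,V)$ with $W$ a set, $R\subseteq W\times W$ and $V:\mathsf{Prop}\to\mathcal{P}(W)$, where $\mathsf{Prop}$ is a set of proposition letters; $w$ satisfies $p$ iff $w\in V(p)$. Write $R[w]=\{v:wRv\}$. For a set $X$, $\mathcal{P}_{\ge n}(X)=\{X'\subseteq X:|X'|\ge n\}$ and $\mathcal{P}_{<\omega}(X)$ is the set of finite subsets of $X$. For $\Gamma\subseteq\mathcal{P}(W)$, $\uparrow\Gamma=\{Y\in\mathcal{P}(W):\exists X\in\Gamma,\ X\subseteq Y\}$ (likewise over $W'$). $Z$-pair: for $X\subseteq W$, $X'\subseteq W'$ and $Z\subseteq W\times W'$, the sets $X$ and $X'$ form a $Z$-pair if $\forall x\in X\,\exists x'\in X':xZx'$ and $\forall x'\in X'\,\exists x\in X:xZx'$. Graded bisimulation: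 a non-empty relation $Z\subseteq W\times W'$ is a graded bisimulation between $\mathcal{M}=(W,R,V)$ and $\mathcal{M}'=(W',R',V')$ if, for all $w\in W$, $w'\in W'$ and $n\in\mathbb{N}$: (Prop) if $wZw'$, then $w$ and $w'$ satisfy the same proposition letters; (Forth) if $wZw'$ and $X\in\uparrow\mathcal{P}_{\ge n}(R[w])$, then there is $X'\subseteq W'$ with $X'\in\uparrow\mathcal{P}_{\ge n}(R'[w'])$ and $\forall x'\in X'\,\exists x\in X:\ xZx'$; (Back) if $wZw'$ and $X'\in\uparrow\mathcal{P}_{\ge n}(R'[w'])$, then there is $X\subseteq W$ with $X\in\uparrow\mathcal{P}_{\ge n}(R[w])$ and $\forall x\in X\,\exists x'\in X':\ xZx'$. Graded tuple bisimulation: a tuple $\mathcal{Z}=(\mathcal{Z}_1,\mathcal{Z}_2,\ldots)$ of relations (indexed by $i\ge1$) is a graded tuple bisimulation between $\mathcal{M}$ and $\mathcal{M}'$ iff: (1) $\mathcal{Z}_1$ is non-empty; (2) for all $i$, $\mathcal{Z}_i\subseteq\mathcal{P}_{<\omega}(W)\times\mathcal{P}_{<\omega}(W')$; (3) if $X\mathcal{Z}_iX'$, then $|X|=|X'|=i$; (4) if $\{w\}\mathcal{Z}_1\{w'\}$, then $w$ and $w'$ satisfy the same proposition letters; (5) if $\{w\}\mathcal{Z}_1\{w'\}$, $X\subseteq R[w]$ and $|X|=i\ge1$, then there exists $X'\in\mathcal{P}_{<\omega}(W')$ with $X'\subseteq R'[w']$ and $X\mathcal{Z}_iX'$; (6)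 if $\{w\}\mathcal{Z}_1\{w'\}$, $X'\subseteq R'[w']$ and $|X'|=i\ge1$, then there exists $X\in\mathcal{P}_{<\omega}(W)$ with $X\subseteq R[w]$ and $X\mathcal{Z}_iX'$; (7) if $X\mathcal{Z}_iX'$, then (a) $\forall x\in X\,\exists x'\in X':\{x\}\mathcal{Z}_1\{x'\}$ and (b) $\forall x'\in X'\,\exists x\in X:\{x\}\mathcal{Z}_1\{x'\}$. *)

theory Defs
  imports Main
begin

text \<open>
  Proposition letters are the elements of the type \<open>'p\<close>; the set of worlds is a carrier set,
  which may be empty or infinite.
\<close>

record ('w, 'p) kripke =
  worlds :: "'w set"
  acc :: "('w \<times> 'w) set"
  val :: "'p \<Rightarrow> 'w set"

definition kripke_model :: "('w, 'p) kripke \<Rightarrow> bool" where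
  "kripke_model M \<longleftrightarrow> acc M \<subseteq> worlds M \<times> worlds M \<and> (\<forall>p. val M p \<subseteq> worlds M)"

definition succs :: "('w, 'p) kripke \<Rightarrow> 'w \<Rightarrow> 'w set" where
  "succs M w = {v. (w, v) \<in> acc M}"

definition same_letters :: "('w, 'p) kripke \<Rightarrow> ('v, 'p) kripke \<Rightarrow> 'w \<Rightarrow> 'v \<Rightarrow> bool" where
  "same_letters M M' w w' \<longleftrightarrow> (\<forall>p. w \<in> val M p \<longleftrightarrow> w' \<in> val M' p)"

text \<open>Infinite sets are listed separately because \<^const>\<open>card\<close> maps them to \<open>0\<close>.\<close>

definition Pow_ge :: "nat \<Rightarrow> 'a set \<Rightarrow> 'a set set" where
  "Pow_ge n X = {Y. Y \<subseteq> X \<and> (infinite Y \<or> n \<le> card Y)}"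

definition upclosure :: "'a set \<Rightarrow> 'a set set \<Rightarrow> 'a set set" where
  "upclosure W \<Gamma> = {Y \<in> Pow W. \<exists>X\<in>\<Gamma>. X \<subseteq> Y}"

definition Z_pair :: "('w \<times> 'v) set \<Rightarrow> 'w set \<Rightarrow> 'v set \<Rightarrow> bool" where
  "Z_pair Z X X' \<longleftrightarrow>
     (\<forall>x\<in>X. \<exists>x'\<in>X'. (x, x') \<in> Z) \<and> (\<forall>x'\<in>X'. \<exists>x\<in>X. (x, x') \<in> Z)"

definition graded_bisim ::
  "('w, 'p) kripke \<Rightarrow> ('v, 'p) kripke \<Rightarrow> ('w \<times> 'v) set \<Rightarrow> bool" where
  "graded_bisim M M' Z \<longleftrightarrow>
     Z \<noteq> {} \<and> Z \<subseteq> worlds M \<times> worlds M' \<and>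
     (\<forall>w\<in>worlds M. \<forall>w'\<in>worlds M'. \<forall>n. (w, w') \<in> Z \<longrightarrow>
        same_letters M M' w w' \<and>
        (\<forall>X \<in> upclosure (worlds M) (Pow_ge n (succs M w)).
           \<exists>X' \<in> upclosure (worlds M') (Pow_ge n (succs M' w')).
             \<forall>x'\<in>X'. \<exists>x\<in>X. (x, x') \<in> Z) \<and>
        (\<forall>X' \<in> upclosure (worlds M') (Pow_ge n (succs M' w')).
           \<exists>X \<in> upclosure (worlds M) (Pow_ge n (succs M w)).
             \<forall>x\<in>X. \<exists>x'\<in>X'. (x, x') \<in> Z))"

text \<open>
  A tuple of relations indexed by \<open>i \<ge> 1\<close> is a function on \<^typ>\<open>nat\<close> whose value at \<open>0\<close> is
  disregarded. For \<open>i \<ge> 1\<close>, \<open>card X = i\<close> entails that \<open>X\<close> is finite.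
\<close>

definition graded_tuple_bisim ::
  "('w, 'p) kripke \<Rightarrow> ('v, 'p) kripke \<Rightarrow> (nat \<Rightarrow> ('w set \<times> 'v set) set) \<Rightarrow> bool" where
  "graded_tuple_bisim M M' \<Z> \<longleftrightarrow>
     \<Z> 1 \<noteq> {} \<and>
     (\<forall>i\<ge>1. \<Z> i \<subseteq> Fpow (worlds M) \<times> Fpow (worlds M')) \<and>
     (\<forall>i\<ge>1. \<forall>X X'. (X, X') \<in> \<Z> i \<longrightarrow> card X = i \<and> card X' = i) \<and>
     (\<forall>w w'. ({w}, {w'}) \<in> \<Z> 1 \<longrightarrow> same_letters M M' w w') \<and>
     (\<forall>w w'. \<forall>i\<ge>1. \<forall>X. ({w}, {w'}) \<in> \<Z> 1 \<and> X \<subseteq> succs M w \<and> card X = i \<longrightarrow>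
        (\<exists>X' \<in> Fpow (worlds M'). X' \<subseteq> succs M' w' \<and> (X, X') \<in> \<Z> i)) \<and>
     (\<forall>w w'. \<forall>i\<ge>1. \<forall>X'. ({w}, {w'}) \<in> \<Z> 1 \<and> X' \<subseteq> succs M' w' \<and> card X' = i \<longrightarrow>
        (\<exists>X \<in> Fpow (worlds M). X \<subseteq> succs M w \<and> (X, X') \<in> \<Z> i)) \<and>
     (\<forall>i\<ge>1. \<forall>X X'. (X, X') \<in> \<Z> i \<longrightarrow>
        (\<forall>x\<in>X. \<exists>x'\<in>X'. ({x}, {x'}) \<in> \<Z> 1) \<and>
        (\<forall>x'\<in>X'. \<exists>x\<in>X. ({x}, {x'}) \<in> \<Z> 1))"

end

theory Submission
  imports Defs
begin

text \<open>
  For a finite set \<open>X\<close> of successors of \<open>w\<close>, let \<open>N\<close> be the set of successors of \<open>w'\<close> that are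
  related to a member of \<open>X\<close>. The condition (Forth) for \<open>X\<close> shows that \<open>N\<close> has at least \<open>|X|\<close>
  members, and for the singletons \<open>{x}\<close> it shows that every \<open>x \<in> X\<close> is related to a member of
  \<open>N\<close>. Choosing one such member for each \<open>x\<close> gives a set of at most \<open>|X|\<close> elements, which can be
  enlarged inside \<open>N\<close> to exactly \<open>|X|\<close> elements without leaving the \<open>Z\<close>-pairs. Thus Hall's
  marriage theorem is not needed: the pairing need not be a bijection.
\<close>

lemma Z_pair_converse: "Z_pair (Z\<inverse>) X' X \<longleftrightarrow> Z_pair Z X X'"
  by (auto simp: Z_pair_def)

text \<open>(Forth) for the converse relation is (Back) for \<open>Z\<close> and vice versa. Hence
  the tuple condition on successors of \<open>w'\<close> can be obtained from the one on successors
  of \<open>w\<close>.\<close>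

lemma graded_bisim_converse:
  assumes "graded_bisim M M' Z"
  shows "graded_bisim M' M (Z\<inverse>)"
proof -
  have letters: "same_letters M' M w' w \<longleftrightarrow> same_letters M M' w w'" for w w'
    by (auto simp: same_letters_def)
  show ?thesis
    unfolding graded_bisim_def
  proof (intro conjI ballI allI impI)
    show "Z\<inverse> \<noteq> {}" "Z\<inverse> \<subseteq> worlds M' \<times> worlds M"
      using assms by (auto simp: graded_bisim_def)
  next
    fix w' w n
    assume "w' \<in> worlds M'" "w \<in> worlds M" "(w', w) \<in> Z\<inverse>"
    then have *: "w \<in> worlds M" "w' \<in> worlds M'" "(w, w') \<in> Z" by auto
    note bisim = assms[unfolded graded_bisim_def, THEN conjunct2, THEN conjunct2,
        rule_format, OF *]
    show "same_letters M' M w' w"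
      using bisim letters by blast
    show "\<exists>X\<in>upclosure (worlds M) (Pow_ge n (succs M w)). \<forall>x\<in>X. \<exists>x'\<in>X'. (x', x) \<in> Z\<inverse>"
      if "X' \<in> upclosure (worlds M') (Pow_ge n (succs M' w'))" for X'
      using bisim[of n] that by simp
    show "\<exists>X'\<in>upclosure (worlds M') (Pow_ge n (succs M' w')). \<forall>x'\<in>X'. \<exists>x\<in>X. (x', x) \<in> Z\<inverse>"
      if "X \<in> upclosure (worlds M) (Pow_ge n (succs M w))" for X
      using bisim[of n] that by simp
  qed
qed

text \<open>Serves to cut a witness of (Forth), which may be infinite, down to a finite set of exact
  size.\<close>

lemma Pow_ge_obtain_card:
  assumes "Y \<in> Pow_ge n X"
  obtains T where "T \<subseteq> X" "finite T" "card T = n"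
proof (cases "finite Y")
  case True
  then obtain T where "T \<subseteq> Y" "card T = n" "finite T"
    using assms obtain_subset_with_card_n[of n Y] by (auto simp: Pow_ge_def)
  then show ?thesis using assms that by (auto simp: Pow_ge_def)
next
  case False
  then obtain T where "T \<subseteq> Y" "card T = n" "finite T"
    using infinite_arbitrarily_large[OF False, of n] by blast
  then show ?thesis using assms that by (auto simp: Pow_ge_def)
qed

lemma exists_Z_pair_same_card:
  assumes "finite X"
    and total: "\<forall>x\<in>X. \<exists>y\<in>S. (x, y) \<in> Z"
    and T: "T \<subseteq> S" "finite T" "card T = card X"
    and T_related: "\<forall>y\<in>T. \<exists>x\<in>X. (x, y) \<in> Z"
  shows "\<exists>X'\<subseteq>S. finite X' \<and> card X' = card X \<and> Z_pair Z X X'"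
proof -
  obtain g where g: "\<And>x. x \<in> X \<Longrightarrow> g x \<in> S \<and> (x, g x) \<in> Z"
    using total by metis
  have "card (g ` X) \<le> card X"
    using \<open>finite X\<close> by (rule card_image_le)
  moreover have "card X \<le> card (g ` X \<union> T)"
    using T \<open>finite X\<close> by (metis Un_upper2 card_mono finite_UnI finite_imageI)
  \<comment> \<open>The lower bound on \<open>X'\<close> gives each \<open>x\<close> its partner
    \<open>g x\<close>. By the upper bound each member of \<open>X'\<close> is some
    \<open>g x\<close> or lies in \<open>T\<close>, so it is related to a member of
    \<open>X\<close>.\<close>
  ultimately obtain X' where X': "g ` X \<subseteq> X'" "X' \<subseteq> g ` X \<union> T" "card X' = card X"
    using exists_subset_between[of "g ` X" "card X" "g ` X \<union> T"] T \<open>finite X\<close> by auto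
  have "finite X'"
    using X'(2) T(2) \<open>finite X\<close> by (meson finite_UnI finite_imageI finite_subset)
  moreover have "X' \<subseteq> S"
    using X'(2) T(1) g by blast
  moreover have "Z_pair Z X X'"
    unfolding Z_pair_def
  proof (intro conjI ballI)
    fix x assume "x \<in> X"
    then show "\<exists>x'\<in>X'. (x, x') \<in> Z" using g X'(1) by blast
  next
    fix x' assume "x' \<in> X'"
    then show "\<exists>x\<in>X. (x, x') \<in> Z" using g X'(2) T_related by blast
  qed
  ultimately show ?thesis using X'(3) by blast
qed

text \<open>The set \<open>X\<close> is a member of its own up-closure, so (Forth) applies with
  \<open>n = card X\<close>. The set it returns may contain worlds that are not successors of
  \<open>w'\<close>; \<open>T\<close> is taken from the part \<open>Y\<close> consisting of
  successors.\<close>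

lemma graded_bisim_related_succs:
  assumes "kripke_model M" and Z: "graded_bisim M M' Z" and ww': "(w, w') \<in> Z"
    and X: "X \<subseteq> succs M w" "finite X"
  shows "\<exists>T\<subseteq>succs M' w'. finite T \<and> card T = card X \<and> (\<forall>y\<in>T. \<exists>x\<in>X. (x, y) \<in> Z)"
proof -
  have "X \<subseteq> worlds M"
    using assms(1) X(1) by (auto simp: kripke_model_def succs_def)
  then have "X \<in> upclosure (worlds M) (Pow_ge (card X) (succs M w))"
    using X by (auto simp: upclosure_def Pow_ge_def)
  moreover have "w \<in> worlds M" "w' \<in> worlds M'"
    using Z ww' by (auto simp: graded_bisim_def)
  ultimately obtain X' where
    X': "X' \<in> upclosure (worlds M') (Pow_ge (card X) (succs M' w'))"
    and rel: "\<forall>x'\<in>X'. \<exists>x\<in>X. (x, x') \<in> Z"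
    using Z ww' unfolding graded_bisim_def by meson
  then obtain Y where Y: "Y \<in> Pow_ge (card X) (succs M' w')" "Y \<subseteq> X'"
    by (auto simp: upclosure_def)
  \<comment> \<open>Regarding \<open>Y\<close> as a subset of itself forces \<open>T\<close> into
    \<open>Y\<close>, hence into \<open>X'\<close>: only for members of \<open>X'\<close> is a
    partner in \<open>X\<close> known.\<close>
  then have "Y \<in> Pow_ge (card X) Y" "Y \<subseteq> succs M' w'"
    by (auto simp: Pow_ge_def)
  moreover from this(1) obtain T where "T \<subseteq> Y" "finite T" "card T = card X"
    by (rule Pow_ge_obtain_card)
  ultimately show ?thesis
    using Y(2) rel by (intro exI[of _ T]) blast
qed

lemma graded_bisim_Z_pair_succs:
  assumes "kripke_model M" and "graded_bisim M M' Z" and "(w, w') \<in> Z"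
    and X: "X \<subseteq> succs M w" "finite X"
  shows "\<exists>X'\<subseteq>succs M' w'. finite X' \<and> card X' = card X \<and> Z_pair Z X X'"
proof -
  have "\<exists>y\<in>succs M' w'. (x, y) \<in> Z" if "x \<in> X" for x
  proof -
    have "{x} \<subseteq> succs M w" using that X by auto
    then obtain T where "T \<subseteq> succs M' w'" "card T = card {x}"
      "\<forall>y\<in>T. \<exists>z\<in>{x}. (z, y) \<in> Z"
      using graded_bisim_related_succs[OF assms(1-3), of "{x}"] by auto
    \<comment> \<open>\<open>T\<close> has one element, and its only possible partner in
      \<open>{x}\<close> is \<open>x\<close>.\<close>
    moreover from this have "T \<noteq> {}" by auto
    ultimately show ?thesis by blast
  qed
  moreover obtain T where "T \<subseteq> succs M' w'" "finite T" "card T = card X"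
    "\<forall>y\<in>T. \<exists>x\<in>X. (x, y) \<in> Z"
    using graded_bisim_related_succs[OF assms] by blast
  ultimately show ?thesis
    using exists_Z_pair_same_card[OF X(2), of "succs M' w'" Z T] by blast
qed

theorem proposition7p9:
  fixes M :: "('w, 'p) kripke" and M' :: "('v, 'p) kripke"
    and Z :: "('w \<times> 'v) set" and \<Z> :: "nat \<Rightarrow> ('w set \<times> 'v set) set"
  assumes "kripke_model M" and "kripke_model M'"
    and "graded_bisim M M' Z"
    and "\<Z> 1 = {({w}, {w'}) | w w'. (w, w') \<in> Z}"
    and "\<And>n. n > 1 \<Longrightarrow>
           \<Z> n = {(X, X'). X \<subseteq> worlds M \<and> X' \<subseteq> worlds M' \<and> card X = n \<and> card X' = n \<and> Z_pair Z X X'}"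
  shows "graded_tuple_bisim M M' \<Z>"
proof -
  have Z_sub: "Z \<noteq> {}" "Z \<subseteq> worlds M \<times> worlds M'"
    and letters: "\<And>w w'. (w, w') \<in> Z \<Longrightarrow> same_letters M M' w w'"
    using assms(3) unfolding graded_bisim_def by (blast, blast, blast)
  have succs_sub: "succs M w \<subseteq> worlds M" "succs M' w' \<subseteq> worlds M'" for w w'
    using assms(1,2) by (auto simp: kripke_model_def succs_def)
  have single: "({w}, {w'}) \<in> \<Z> 1 \<longleftrightarrow> (w, w') \<in> Z" for w w'
    unfolding assms(4) by auto
  \<comment> \<open>Two singletons form a \<open>Z\<close>-pair iff their elements are related, so
    the separate definition at index 1 agrees with the general one.\<close>
  have mem: "(X, X') \<in> \<Z> i \<longleftrightarrow> X \<subseteq> worlds M \<and> X' \<subseteq> worlds M' \<and> card X = i \<and> card X' = i \<and> Z_pair Z X X'"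
    if "i \<ge> 1" for i X X'
  proof (cases "i = 1")
    case True
    show ?thesis
      unfolding True assms(4) using Z_sub(2)
      by (auto simp: Z_pair_def card_1_singleton_iff)
  next
    case False
    then show ?thesis using that assms(5)[of i] by auto
  qed
  show ?thesis
    unfolding graded_tuple_bisim_def
  proof (intro conjI allI impI)
    show "\<Z> 1 \<noteq> {}"
      using Z_sub(1) single by fastforce
  next
    fix i :: nat assume "i \<ge> 1"
    then show "\<Z> i \<subseteq> Fpow (worlds M) \<times> Fpow (worlds M')"
      by (auto simp: Fpow_def mem intro!: card_ge_0_finite)
  next
    fix i X X' assume "1 \<le> i" "(X, X') \<in> \<Z> i"
    then show "card X = i" "card X' = i" using mem by auto
  next
    fix w w' assume "({w}, {w'}) \<in> \<Z> 1"
    then show "same_letters M M' w w'" using single letters by blast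
  next
    fix w w' i X
    assume i: "1 \<le> i" and "({w}, {w'}) \<in> \<Z> 1 \<and> X \<subseteq> succs M w \<and> card X = i"
    then have X: "(w, w') \<in> Z" "X \<subseteq> succs M w" "card X = i" using single by auto
    \<comment> \<open>An infinite set has \<open>card\<close> 0, which \<open>i \<ge> 1\<close>
      excludes.\<close>
    moreover have "finite X" using X(3) i by (intro card_ge_0_finite) simp
    ultimately obtain X' where "X' \<subseteq> succs M' w'" "finite X'" "card X' = i" "Z_pair Z X X'"
      using graded_bisim_Z_pair_succs[OF assms(1,3) X(1,2)] by auto
    moreover from this X(2) have "X \<subseteq> worlds M" "X' \<subseteq> worlds M'"
      using succs_sub by (meson order_trans)+
    ultimately show "\<exists>X'\<in>Fpow (worlds M'). X' \<subseteq> succs M' w' \<and> (X, X') \<in> \<Z> i"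
      using X mem[OF i] by (intro bexI[of _ X']) (auto simp: Fpow_def)
  next
    fix w w' i X'
    assume i: "1 \<le> i" and "({w}, {w'}) \<in> \<Z> 1 \<and> X' \<subseteq> succs M' w' \<and> card X' = i"
    then have X': "(w', w) \<in> Z\<inverse>" "X' \<subseteq> succs M' w'" "card X' = i" using single by auto
    moreover have "finite X'" using X'(3) i by (intro card_ge_0_finite) simp
    ultimately obtain X where "X \<subseteq> succs M w" "finite X" "card X = i" "Z_pair (Z\<inverse>) X' X"
      \<comment> \<open>The forward result is applied to the converse relation, with the two models
        exchanged.\<close>
      using graded_bisim_Z_pair_succs[OF assms(2) graded_bisim_converse[OF assms(3)] X'(1,2)] by auto
    moreover from this X'(2) have "X \<subseteq> worlds M" "X' \<subseteq> worlds M'"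
      using succs_sub by (meson order_trans)+
    ultimately show "\<exists>X\<in>Fpow (worlds M). X \<subseteq> succs M w \<and> (X, X') \<in> \<Z> i"
      using X' mem[OF i]
      by (intro bexI[of _ X]) (auto simp: Fpow_def Z_pair_converse)
  next
    fix i X X' assume "1 \<le> i" "(X, X') \<in> \<Z> i"
    then have "Z_pair Z X X'" using mem by auto
    then show "\<forall>x\<in>X. \<exists>x'\<in>X'. ({x}, {x'}) \<in> \<Z> 1" "\<forall>x'\<in>X'. \<exists>x\<in>X. ({x}, {x'}) \<in> \<Z> 1"
      using single by (auto simp: Z_pair_def)
  qed
qed

end
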